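(* Let $(X,\cdot)$ and $(Y,* )$ be two right P{\l}onka magmas. The following conditions are equivalent: (1) $(X,\cdot)$ and $(Y,* )$ are isomorphic as magmas. (2) Writing $(X_i,f_i^j)_{i,j\in I}$ and $(Y_\alpha,g_\alpha^\beta)_{\alpha,\beta\in A}$ for the coarsest P{\l}onka partitions of $(X,\cdot)$ and $(Y,* )$ respectively, there is a bijection $\theta:I\to A$ and, for each $i\in I$, an isomorphism $\{f_i^j\}_{j\in I}\cong\{g_{\theta(i)}^{\theta(j)}\}_{j\in I}$ of families of self-functions, i.e. a bijection $\sigma_i:X_i\to Y_{\theta(i)}$ with $\sigma_i\circ f_i^j=g_{\theta(i)}^{\theta(j)}\circ\sigma_i$ for all $j\in I$. (3) The same as (2), with the finest P{\l}onka partitions of $(X,\cdot)$ and $(Y,* )$ in place of the coarsest ones.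
   Context: A right P{\l}onka magma is a set $X$ with a binary operation such that $(x\cdot y)\cdot z=(x\cdot z)\cdot y$ and $x\cdot(y\cdot z)=x\cdot y$ for all $x,y,z\in X$. A P{\l}onka partition of $(X,\cdot)$ is a structure $(X_i,f_i^j)$ consisting of a partition $X=\coprod_{i\in I}X_i$ into non-empty parts and functions $f_i^j:X_i\to X_i$ ($i,j\in I$) with $f_i^j\circ f_i^k=f_i^k\circ f_i^j$ for all $i,j,k$ and $x_i\cdot x_j=f_i^j(x_i)$ for all $x_i\in X_i$, $x_j\in X_j$. Given two P{\l}onka partitions $\mathcal{X}=(X_i,f_i^j)$ and $\mathcal{Y}=(Y_\alpha,f_\alpha^\beta)$ of the same magma, $\mathcal{X}$ is coarser than $\mathcal{Y}$ (and $\mathcal{Y}$ finer than $\mathcal{X}$) if every $Y_\alpha$ is contained in some $X_i$ and $f_\alpha^\beta=f_i^j|_{Y_\alpha}$ whenever $Y_\alpha\subseteq X_i$, $Y_\beta\subseteq X_j$. Every right P{\l}onka magma has a unique coarsest P{\l}onka partition (its parts are the classes of the relation $a\approx b\iff x\cdot a=x\cdot b$ for all $x$) and a unique finest one (characterized by the condition that for each $i$ the family $\{f_i^j\}_{j\in I}$ is connected, i.e. $X_i$ admits no partition into at least two non-empty parts each invariant under all $f_i^j$, $j\in I$). *)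

theory Defs
  imports Main "HOL-Library.Disjoint_Sets" "HOL-Library.FuncSet"
begin

definition right_plonka_magma :: "'a set \<Rightarrow> ('a \<Rightarrow> 'a \<Rightarrow> 'a) \<Rightarrow> bool" where
  "right_plonka_magma X m \<longleftrightarrow>
     (\<forall>x\<in>X. \<forall>y\<in>X. m x y \<in> X) \<and>
     (\<forall>x\<in>X. \<forall>y\<in>X. \<forall>z\<in>X. m (m x y) z = m (m x z) y) \<and>
     (\<forall>x\<in>X. \<forall>y\<in>X. \<forall>z\<in>X. m x (m y z) = m x y)"

definition magma_isomorphic ::
    "'a set \<Rightarrow> ('a \<Rightarrow> 'a \<Rightarrow> 'a) \<Rightarrow> 'b set \<Rightarrow> ('b \<Rightarrow> 'b \<Rightarrow> 'b) \<Rightarrow> bool" where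
  "magma_isomorphic X m Y n \<longleftrightarrow>
     (\<exists>h. bij_betw h X Y \<and> (\<forall>x\<in>X. \<forall>y\<in>X. h (m x y) = n (h x) (h y)))"

text \<open>The function \<open>func \<X> i j\<close> stands for $f_i^j$. It is a total HOL function, but only its
  values on \<open>part \<X> i\<close>, for \<open>i\<close> and \<open>j\<close> in the index set, are meaningful.\<close>

record ('i, 'a) part_system =
  index :: "'i set"
  part :: "'i \<Rightarrow> 'a set"
  func :: "'i \<Rightarrow> 'i \<Rightarrow> 'a \<Rightarrow> 'a"

definition plonka_partition ::
    "'a set \<Rightarrow> ('a \<Rightarrow> 'a \<Rightarrow> 'a) \<Rightarrow> ('i, 'a) part_system \<Rightarrow> bool" where
  "plonka_partition X m \<X> \<longleftrightarrow>
     (\<Union>i\<in>index \<X>. part \<X> i) = X \<and>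
     disjoint_family_on (part \<X>) (index \<X>) \<and>
     (\<forall>i\<in>index \<X>. part \<X> i \<noteq> {}) \<and>
     (\<forall>i\<in>index \<X>. \<forall>j\<in>index \<X>. func \<X> i j \<in> part \<X> i \<rightarrow> part \<X> i) \<and>
     (\<forall>i\<in>index \<X>. \<forall>j\<in>index \<X>. \<forall>k\<in>index \<X>. \<forall>x\<in>part \<X> i.
        func \<X> i j (func \<X> i k x) = func \<X> i k (func \<X> i j x)) \<and>
     (\<forall>i\<in>index \<X>. \<forall>j\<in>index \<X>. \<forall>x\<in>part \<X> i. \<forall>y\<in>part \<X> j. m x y = func \<X> i j x)"

definition coarser :: "('i, 'a) part_system \<Rightarrow> ('k, 'a) part_system \<Rightarrow> bool" where
  "coarser \<X> \<Y> \<longleftrightarrow>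
     (\<forall>a\<in>index \<Y>. \<exists>i\<in>index \<X>. part \<Y> a \<subseteq> part \<X> i) \<and>
     (\<forall>a\<in>index \<Y>. \<forall>b\<in>index \<Y>. \<forall>i\<in>index \<X>. \<forall>j\<in>index \<X>.
        part \<Y> a \<subseteq> part \<X> i \<longrightarrow> part \<Y> b \<subseteq> part \<X> j \<longrightarrow>
        (\<forall>x\<in>part \<Y> a. func \<Y> a b x = func \<X> i j x))"

text \<open>A definition cannot quantify over all index types. The competing partitions are therefore
  indexed by sets of elements, which is enough to index any partition by its own parts; the lemmas
  \<open>coarsest_coarser\<close> and \<open>finest_finer\<close> below give the comparison for every index type.\<close>

definition coarsest_plonka_partition ::
    "'a set \<Rightarrow> ('a \<Rightarrow> 'a \<Rightarrow> 'a) \<Rightarrow> ('i, 'a) part_system \<Rightarrow> bool" where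
  "coarsest_plonka_partition X m \<X> \<longleftrightarrow> plonka_partition X m \<X> \<and>
     (\<forall>\<Y> :: ('a set, 'a) part_system. plonka_partition X m \<Y> \<longrightarrow> coarser \<X> \<Y>)"

definition finest_plonka_partition ::
    "'a set \<Rightarrow> ('a \<Rightarrow> 'a \<Rightarrow> 'a) \<Rightarrow> ('i, 'a) part_system \<Rightarrow> bool" where
  "finest_plonka_partition X m \<X> \<longleftrightarrow> plonka_partition X m \<X> \<and>
     (\<forall>\<Y> :: ('a set, 'a) part_system. plonka_partition X m \<Y> \<longrightarrow> coarser \<Y> \<X>)"

definition family_isomorphic ::
    "'j set \<Rightarrow> 'a set \<Rightarrow> ('j \<Rightarrow> 'a \<Rightarrow> 'a) \<Rightarrow> 'b set \<Rightarrow> ('j \<Rightarrow> 'b \<Rightarrow> 'b) \<Rightarrow> bool" where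
  "family_isomorphic J S f T g \<longleftrightarrow>
     (\<exists>\<sigma>. bij_betw \<sigma> S T \<and> (\<forall>j\<in>J. \<forall>x\<in>S. \<sigma> (f j x) = g j (\<sigma> x)))"

definition part_systems_isomorphic ::
    "('i, 'a) part_system \<Rightarrow> ('k, 'b) part_system \<Rightarrow> bool" where
  "part_systems_isomorphic \<X> \<Y> \<longleftrightarrow>
     (\<exists>\<theta>. bij_betw \<theta> (index \<X>) (index \<Y>) \<and>
        (\<forall>i\<in>index \<X>.
           family_isomorphic (index \<X>) (part \<X> i) (func \<X> i)
             (part \<Y> (\<theta> i)) (\<lambda>j. func \<Y> (\<theta> i) (\<theta> j))))"

subsection \<open>Independence of the index type, existence\<close>

lemma plonka_partition_func:
  assumes "plonka_partition X m \<X>" "i \<in> index \<X>" "j \<in> index \<X>" "x \<in> part \<X> i" "y \<in> part \<X> j"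
  shows "func \<X> i j x = m x y"
  using assms unfolding plonka_partition_def by auto

lemma coarser_if_parts_subset:
  assumes "plonka_partition X m \<X>" "plonka_partition X m \<Y>"
    and sub: "\<forall>a\<in>index \<Y>. \<exists>i\<in>index \<X>. part \<Y> a \<subseteq> part \<X> i"
  shows "coarser \<X> \<Y>"
  unfolding coarser_def
proof (intro conjI ballI impI)
  fix a b i j x
  assume *: "a \<in> index \<Y>" "b \<in> index \<Y>" "i \<in> index \<X>" "j \<in> index \<X>"
    "part \<Y> a \<subseteq> part \<X> i" "part \<Y> b \<subseteq> part \<X> j" "x \<in> part \<Y> a"
  obtain y where y: "y \<in> part \<Y> b"
    using assms(2) * unfolding plonka_partition_def by blast
  have "func \<Y> a b x = m x y"
    by (rule plonka_partition_func[OF assms(2)]) (use * y in auto)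
  moreover have "func \<X> i j x = m x y"
    by (rule plonka_partition_func[OF assms(1)]) (use * y in auto)
  ultimately show "func \<Y> a b x = func \<X> i j x" by simp
qed (use sub in auto)

lemma plonka_partition_reindex:
  assumes p: "plonka_partition X m (\<X> :: ('i, 'a) part_system)"
  obtains \<Y> :: "('a set, 'a) part_system"
  where "plonka_partition X m \<Y>" "index \<Y> = part \<X> ` index \<X>" "part \<Y> = id"
proof -
  have inj: "inj_on (part \<X>) (index \<X>)"
    using p unfolding plonka_partition_def inj_on_def disjoint_family_on_def by (metis inf.idem)
  define r where "r = the_inv_into (index \<X>) (part \<X>)"
  have r: "r (part \<X> i) = i" if "i \<in> index \<X>" for i
    unfolding r_def by (rule the_inv_into_f_f[OF inj that])
  define \<Y> where "\<Y> = \<lparr>index = part \<X> ` index \<X>, part = id, func = (\<lambda>A B. func \<X> (r A) (r B))\<rparr>"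
  have "plonka_partition X m \<Y>"
    using p inj unfolding plonka_partition_def disjoint_family_on_def \<Y>_def
    by (simp add: r) (metis)
  then show ?thesis using that[of \<Y>] by (simp add: \<Y>_def)
qed

lemma coarsest_coarser:
  assumes "coarsest_plonka_partition X m \<X>" "plonka_partition X m \<Y>"
  shows "coarser \<X> \<Y>"
proof -
  obtain \<Z> :: "('a set, 'a) part_system" where \<Z>: "plonka_partition X m \<Z>"
    "index \<Z> = part \<Y> ` index \<Y>" "part \<Z> = id"
    using plonka_partition_reindex[OF assms(2)] by blast
  have "coarser \<X> \<Z>" "plonka_partition X m \<X>"
    using assms(1) \<Z>(1) unfolding coarsest_plonka_partition_def by auto
  then show ?thesis
    by (intro coarser_if_parts_subset[OF _ assms(2)]) (auto simp: coarser_def \<Z>)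
qed

lemma finest_finer:
  assumes "finest_plonka_partition X m \<X>" "plonka_partition X m \<Y>"
  shows "coarser \<Y> \<X>"
proof -
  obtain \<Z> :: "('a set, 'a) part_system" where \<Z>: "plonka_partition X m \<Z>"
    "index \<Z> = part \<Y> ` index \<Y>" "part \<Z> = id"
    using plonka_partition_reindex[OF assms(2)] by blast
  have "coarser \<Z> \<X>" "plonka_partition X m \<X>"
    using assms(1) \<Z>(1) unfolding finest_plonka_partition_def by auto
  then show ?thesis
    by (intro coarser_if_parts_subset[OF assms(2)]) (auto simp: coarser_def \<Z>)
qed

lemma plonka_partition_quotient:
  assumes M: "right_plonka_magma X m" and E: "equiv X E"
    and left: "\<And>x y. x \<in> X \<Longrightarrow> y \<in> X \<Longrightarrow> (x, m x y) \<in> E"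
    and right: "\<And>x a b. x \<in> X \<Longrightarrow> (a, b) \<in> E \<Longrightarrow> m x a = m x b"
  shows "plonka_partition X m
    \<lparr>index = X // E, part = id, func = (\<lambda>A B x. m x (SOME b. b \<in> B))\<rparr>"
proof -
  have some: "(SOME b. b \<in> B) \<in> B" if "B \<in> X // E" for B
    using in_quotient_imp_non_empty[OF E that] by (simp add: some_in_eq)
  have sub: "B \<subseteq> X" if "B \<in> X // E" for B
    using in_quotient_imp_subset[OF E that] .
  have cl: "m x b \<in> A" if "A \<in> X // E" "x \<in> A" "b \<in> X" for A x b
    using in_quotient_imp_closed[OF E that(1,2)] left[of x b] sub that by blast
  have eq: "m x y = m x (SOME b. b \<in> B)" if "x \<in> X" "B \<in> X // E" "y \<in> B" for x y B
    using right[OF that(1)] in_quotient_imp_in_rel[OF E that(2), of y] some[OF that(2)] that(3)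
    by blast
  show ?thesis
    unfolding plonka_partition_def part_system.simps id_apply
  proof (intro conjI ballI)
    show "(\<Union>i\<in>X // E. i) = X" using Union_quotient[OF E] by simp
    show "disjoint_family_on (\<lambda>A. A) (X // E)"
      using quotient_disj[OF E] unfolding disjoint_family_on_def by fastforce
    show "A \<noteq> {}" if "A \<in> X // E" for A using in_quotient_imp_non_empty[OF E that] .
    show "(\<lambda>x. m x (SOME b. b \<in> B)) \<in> A \<rightarrow> A" if "A \<in> X // E" "B \<in> X // E" for A B
      using cl some sub that by blast
    show "m (m x (SOME b. b \<in> C)) (SOME b. b \<in> B) = m (m x (SOME b. b \<in> B)) (SOME b. b \<in> C)"
      if "A \<in> X // E" "B \<in> X // E" "C \<in> X // E" "x \<in> A" for A B C x
    proof -
      have "x \<in> X" "(SOME b. b \<in> B) \<in> X" "(SOME b. b \<in> C) \<in> X"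
        using that some sub by blast+
      then show ?thesis using M unfolding right_plonka_magma_def by blast
    qed
    show "m x y = m x (SOME b. b \<in> B)"
      if "A \<in> X // E" "B \<in> X // E" "x \<in> A" "y \<in> B" for A B x y
      using eq sub that by blast
  qed
qed

lemma ex_coarsest_plonka_partition:
  assumes M: "right_plonka_magma X m"
  shows "\<exists>\<X> :: ('a set, 'a) part_system. coarsest_plonka_partition X m \<X>"
proof -
  define E where "E = {(a, b). a \<in> X \<and> b \<in> X \<and> (\<forall>x\<in>X. m x a = m x b)}"
  have E: "equiv X E" unfolding E_def equiv_def refl_on_def sym_def trans_def by auto
  define \<X> where "\<X> = \<lparr>index = X // E, part = id, func = (\<lambda>A B x. m x (SOME b. b \<in> B))\<rparr>"
  have p: "plonka_partition X m \<X>"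
    unfolding \<X>_def by (rule plonka_partition_quotient[OF M E])
      (use M in \<open>auto simp: E_def right_plonka_magma_def\<close>)
  have "coarser \<X> \<Y>" if q: "plonka_partition X m \<Y>" for \<Y> :: "('a set, 'a) part_system"
  proof (rule coarser_if_parts_subset[OF p q], intro ballI)
    fix a assume a: "a \<in> index \<Y>"
    obtain y where y: "y \<in> part \<Y> a" using q a unfolding plonka_partition_def by blast
    have X: "(\<Union>i\<in>index \<Y>. part \<Y> i) = X" using q unfolding plonka_partition_def by blast
    have "part \<Y> a \<subseteq> E `` {y}"
    proof
      fix z assume z: "z \<in> part \<Y> a"
      have "m x y = m x z" if x: "x \<in> X" for x
      proof -
        obtain i where i: "i \<in> index \<Y>" "x \<in> part \<Y> i" using X x by blast
        show ?thesis
          using plonka_partition_func[OF q i(1) a i(2) y] plonka_partition_func[OF q i(1) a i(2) z]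
          by simp
      qed
      then show "z \<in> E `` {y}" unfolding E_def using X a y z by auto
    qed
    moreover have "E `` {y} \<in> X // E" using X a y by (intro quotientI) auto
    ultimately show "\<exists>i\<in>index \<X>. part \<Y> a \<subseteq> part \<X> i" unfolding \<X>_def by auto
  qed
  then show ?thesis unfolding coarsest_plonka_partition_def using p by blast
qed

lemma ex_finest_plonka_partition:
  assumes M: "right_plonka_magma X m"
  shows "\<exists>\<X> :: ('a set, 'a) part_system. finest_plonka_partition X m \<X>"
proof -
  define R where "R = {(x, m x y) | x y. x \<in> X \<and> y \<in> X}"
  define E where "E = Restr ((R \<union> R\<inverse>)\<^sup>*) X"
  have "sym ((R \<union> R\<inverse>)\<^sup>*)" by (intro sym_rtrancl sym_Un_converse)
  then have E: "equiv X E"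
    unfolding E_def equiv_def refl_on_def sym_def trans_def by (auto intro: rtrancl_trans)
  have right: "m x a = m x b" if x: "x \<in> X" and "(a, b) \<in> (R \<union> R\<inverse>)\<^sup>*" for x a b
    using that(2)
  proof (induction rule: rtrancl_induct)
    case (step y z)
    then show ?case using M x unfolding R_def right_plonka_magma_def by auto
  qed simp
  define \<X> where "\<X> = \<lparr>index = X // E, part = id, func = (\<lambda>A B x. m x (SOME b. b \<in> B))\<rparr>"
  have p: "plonka_partition X m \<X>"
    unfolding \<X>_def
  proof (rule plonka_partition_quotient[OF M E])
    show "(x, m x y) \<in> E" if "x \<in> X" "y \<in> X" for x y
    proof -
      have "(x, m x y) \<in> R" unfolding R_def using that by blast
      then show ?thesis using M that unfolding E_def right_plonka_magma_def by auto
    qed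
  qed (use right in \<open>auto simp: E_def\<close>)
  have "coarser \<Y> \<X>" if q: "plonka_partition X m \<Y>" for \<Y> :: "('a set, 'a) part_system"
  proof (rule coarser_if_parts_subset[OF q p], intro ballI)
    fix A assume A: "A \<in> index \<X>"
    obtain a where a: "a \<in> X" "A = E `` {a}" using A unfolding \<X>_def by (auto elim: quotientE)
    have X: "(\<Union>i\<in>index \<Y>. part \<Y> i) = X" using q unfolding plonka_partition_def by blast
    obtain i where i: "i \<in> index \<Y>" "a \<in> part \<Y> i" using X a by blast
    have inv: "m x y \<in> part \<Y> k" if k: "k \<in> index \<Y>" "x \<in> part \<Y> k" "y \<in> X" for k x y
    proof -
      obtain j where j: "j \<in> index \<Y>" "y \<in> part \<Y> j" using X k by blast
      have "func \<Y> k j x \<in> part \<Y> k"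
        using q k j unfolding plonka_partition_def by blast
      then show ?thesis using plonka_partition_func[OF q k(1) j(1) k(2) j(2)] by simp
    qed
    have "b \<in> part \<Y> i" if "(a, b) \<in> (R \<union> R\<inverse>)\<^sup>*" for b
      using that
    proof (induction rule: rtrancl_induct)
      case (step y z)
      from step(2) consider w where "w \<in> X" "z = m y w" | w where "z \<in> X" "w \<in> X" "y = m z w"
        unfolding R_def by blast
      then show ?case
      proof cases
        case 1
        then show ?thesis using inv i step.IH by blast
      next
        case 2
        obtain k where k: "k \<in> index \<Y>" "z \<in> part \<Y> k" using X 2 by blast
        then have "y \<in> part \<Y> k" using inv 2 by blast
        then have "k = i"
          using q k i step.IH unfolding plonka_partition_def disjoint_family_on_def by blast
        then show ?thesis using k by simp
      qed
    qed (use i in simp)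
    then show "\<exists>i\<in>index \<Y>. part \<X> A \<subseteq> part \<Y> i"
      using i a unfolding \<X>_def E_def by auto
  qed
  then show ?thesis unfolding finest_plonka_partition_def using p by blast
qed

end

theory Submission
  imports Defs
begin

text \<open>An isomorphism carries P{\l}onka partitions to P{\l}onka partitions and preserves the
  relation of being coarser, hence it carries the coarsest (finest) partition to the coarsest
  (finest) one, and these are unique up to the choice of indices. Conversely, the bijections
  between the parts glue to an isomorphism, because the product is determined by the
  functions of the partition.\<close>

section \<open>Magma isomorphisms with an explicit map, and their inverses\<close>

definition magma_isomorphism ::
    "('a \<Rightarrow> 'b) \<Rightarrow> 'a set \<Rightarrow> ('a \<Rightarrow> 'a \<Rightarrow> 'a) \<Rightarrow> 'b set \<Rightarrow> ('b \<Rightarrow> 'b \<Rightarrow> 'b) \<Rightarrow> bool" where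
  "magma_isomorphism h X m Y n \<longleftrightarrow>
     bij_betw h X Y \<and> (\<forall>x\<in>X. \<forall>y\<in>X. h (m x y) = n (h x) (h y))"

lemma magma_isomorphic_iff: "magma_isomorphic X m Y n \<longleftrightarrow> (\<exists>h. magma_isomorphism h X m Y n)"
  unfolding magma_isomorphic_def magma_isomorphism_def ..

text \<open>Closure of \<open>X\<close> under \<open>m\<close> enters because
  \<open>inv_into X h\<close> is known to undo \<open>h\<close> only on \<open>X\<close>, so
  \<open>m x y\<close> has to lie there before it can be recovered from its image.\<close>

lemma magma_isomorphism_inv_into:
  assumes h: "magma_isomorphism h X m Y n"
    and closed: "\<And>x y. x \<in> X \<Longrightarrow> y \<in> X \<Longrightarrow> m x y \<in> X"
  shows "magma_isomorphism (inv_into X h) Y n X m"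
  unfolding magma_isomorphism_def
proof (intro conjI ballI)
  have bij: "bij_betw h X Y" using h unfolding magma_isomorphism_def by blast
  then show "bij_betw (inv_into X h) Y X" by (rule bij_betw_inv_into)
  fix u v assume "u \<in> Y" "v \<in> Y"
  then obtain x y where "x \<in> X" "u = h x" "y \<in> X" "v = h y"
    using bij unfolding bij_betw_def by blast
  moreover from this have "n u v = h (m x y)" using h unfolding magma_isomorphism_def by simp
  ultimately show "inv_into X h (n u v) = m (inv_into X h u) (inv_into X h v)"
    using closed bij_betw_imp_inj_on[OF bij] by simp
qed

section \<open>Parts of a partition, and antisymmetry of comparison\<close>

lemma plonka_partition_part_subset:
  assumes "plonka_partition X m \<X>" "i \<in> index \<X>"
  shows "part \<X> i \<subseteq> X"
  using assms unfolding plonka_partition_def by blast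

lemma plonka_partition_part_nonempty:
  assumes "plonka_partition X m \<X>" "i \<in> index \<X>"
  shows "part \<X> i \<noteq> {}"
  using assms unfolding plonka_partition_def by blast

lemma plonka_partition_index_unique:
  assumes "plonka_partition X m \<X>" "i \<in> index \<X>" "j \<in> index \<X>" "x \<in> part \<X> i" "x \<in> part \<X> j"
  shows "i = j"
  using assms unfolding plonka_partition_def disjoint_family_on_def by blast

lemma plonka_partition_inj_on_part:
  assumes "plonka_partition X m \<X>"
  shows "inj_on (part \<X>) (index \<X>)"
  using plonka_partition_part_nonempty[OF assms] plonka_partition_index_unique[OF assms]
  by (intro inj_onI) blast

text \<open>A part of one partition lies in a part of the other, which lies in a part of the first.
  The two outer parts share a point, so they coincide and the middle one equals both. The sets of
  parts are compared, rather than the systems, because the index types may differ.\<close>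

lemma coarser_antisym_parts:
  assumes p: "plonka_partition X m \<X>" and q: "plonka_partition X m \<Y>"
    and "coarser \<X> \<Y>" "coarser \<Y> \<X>"
  shows "part \<X> ` index \<X> = part \<Y> ` index \<Y>"
proof -
  \<comment> \<open>This inclusion has index types of its own, so it can be instantiated in both
    directions.\<close>
  have "part \<P> ` index \<P> \<subseteq> part \<Q> ` index \<Q>"
    if P: "plonka_partition X m \<P>" and PQ: "coarser \<P> \<Q>" and QP: "coarser \<Q> \<P>"
    for \<P> :: "('r, 'a) part_system" and \<Q> :: "('s, 'a) part_system"
  proof (rule image_subsetI)
    fix i assume i: "i \<in> index \<P>"
    obtain a where a: "a \<in> index \<Q>" "part \<P> i \<subseteq> part \<Q> a"
      using QP i unfolding coarser_def by blast
    obtain j where j: "j \<in> index \<P>" "part \<Q> a \<subseteq> part \<P> j"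
      using PQ a unfolding coarser_def by blast
    obtain x where "x \<in> part \<P> i" using plonka_partition_part_nonempty[OF P i] by blast
    then have "i = j" using plonka_partition_index_unique[OF P i j(1)] a j by blast
    then show "part \<P> i \<in> part \<Q> ` index \<Q>" using a j by blast
  qed
  then show ?thesis using assms by (metis subset_antisym)
qed

section \<open>Transport of partitions along an isomorphism\<close>

definition transport :: "('a \<Rightarrow> 'b) \<Rightarrow> 'a set \<Rightarrow> ('i, 'a) part_system \<Rightarrow> ('i, 'b) part_system" where
  "transport h X \<X> = \<lparr>index = index \<X>, part = (\<lambda>i. h ` part \<X> i),
     func = (\<lambda>i j y. h (func \<X> i j (inv_into X h y)))\<rparr>"

lemma transport_sel [simp]:
  "index (transport h X \<X>) = index \<X>"
  "part (transport h X \<X>) i = h ` part \<X> i"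
  "func (transport h X \<X>) i j y = h (func \<X> i j (inv_into X h y))"
  by (simp_all add: transport_def)

text \<open>The indices are kept and the functions are conjugated by \<open>h\<close>. On the image
  of a part, \<open>inv_into X h\<close> undoes \<open>h\<close>, so commutation carries over, and
  the product formula becomes the homomorphism property of \<open>h\<close>.\<close>

lemma plonka_partition_transport:
  assumes h: "magma_isomorphism h X m Y n" and p: "plonka_partition X m \<X>"
  shows "plonka_partition Y n (transport h X \<X>)"
proof -
  have bij: "bij_betw h X Y" and hom: "\<And>x y. x \<in> X \<Longrightarrow> y \<in> X \<Longrightarrow> h (m x y) = n (h x) (h y)"
    using h unfolding magma_isomorphism_def by auto
  have inj: "inj_on h X" using bij by (rule bij_betw_imp_inj_on)
  note sub = plonka_partition_part_subset[OF p]
  have inv: "inv_into X h (h x) = x" if "i \<in> index \<X>" "x \<in> part \<X> i" for i x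
    using inj sub that by (meson inv_into_f_f subsetD)
  have cl: "func \<X> i j x \<in> part \<X> i" if "i \<in> index \<X>" "j \<in> index \<X>" "x \<in> part \<X> i" for i j x
    using p that unfolding plonka_partition_def by blast
  show ?thesis
    unfolding plonka_partition_def transport_sel
  proof (intro conjI ballI)
    have "(\<Union>i\<in>index \<X>. part \<X> i) = X" using p unfolding plonka_partition_def by blast
    then show "(\<Union>i\<in>index \<X>. h ` part \<X> i) = Y"
      using bij unfolding bij_betw_def by blast
    show "disjoint_family_on (\<lambda>i. h ` part \<X> i) (index \<X>)"
      unfolding disjoint_family_on_def
    proof (intro ballI impI)
      fix i j assume "i \<in> index \<X>" "j \<in> index \<X>" "i \<noteq> j"
      moreover from this have "part \<X> i \<inter> part \<X> j = {}"
        using p unfolding plonka_partition_def disjoint_family_on_def by blast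
      ultimately show "h ` part \<X> i \<inter> h ` part \<X> j = {}"
        using inj_on_image_Int[OF inj sub sub, of i j] by simp
    qed
    show "h ` part \<X> i \<noteq> {}" if "i \<in> index \<X>" for i
      using plonka_partition_part_nonempty[OF p that] by simp
    show "(\<lambda>y. h (func \<X> i j (inv_into X h y))) \<in> h ` part \<X> i \<rightarrow> h ` part \<X> i"
      if "i \<in> index \<X>" "j \<in> index \<X>" for i j
      using that cl inv by auto
    show "h (func \<X> i j (inv_into X h (h (func \<X> i k (inv_into X h y))))) =
        h (func \<X> i k (inv_into X h (h (func \<X> i j (inv_into X h y)))))"
      if ijk: "i \<in> index \<X>" "j \<in> index \<X>" "k \<in> index \<X>" "y \<in> h ` part \<X> i" for i j k y
    proof -
      obtain x where x: "x \<in> part \<X> i" "y = h x" using ijk by blast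
      have "func \<X> i j (func \<X> i k x) = func \<X> i k (func \<X> i j x)"
        using p ijk x unfolding plonka_partition_def by blast
      then show ?thesis using x ijk by (simp add: inv[OF ijk(1)] cl)
    qed
    show "n u v = h (func \<X> i j (inv_into X h u))"
      if ij: "i \<in> index \<X>" "j \<in> index \<X>" "u \<in> h ` part \<X> i" "v \<in> h ` part \<X> j" for i j u v
    proof -
      obtain x y where xy: "x \<in> part \<X> i" "u = h x" "y \<in> part \<X> j" "v = h y" using ij by blast
      then have "x \<in> X" "y \<in> X" using sub ij by blast+
      then have "n u v = h (m x y)" using hom xy by simp
      then show ?thesis
        using xy ij by (simp add: inv plonka_partition_func[OF p ij(1,2)])
    qed
  qed
qed

text \<open>Used to move an inclusion between parts back and forth between \<open>X\<close> and
  \<open>Y\<close>: on subsets of \<open>X\<close> and \<open>Y\<close> the two image maps cancel,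
  and both are monotone.\<close>

lemma subset_transport_inv_into:
  assumes "bij_betw h X Y" "A \<subseteq> X" "B \<subseteq> Y"
  shows "inv_into X h ` B \<subseteq> A \<longleftrightarrow> B \<subseteq> h ` A" "A \<subseteq> inv_into X h ` B \<longleftrightarrow> h ` A \<subseteq> B"
proof -
  have *: "h ` inv_into X h ` B = B" "inv_into X h ` h ` A = A"
    using assms by (auto simp: bij_betw_def image_inv_into_cancel)
  show "inv_into X h ` B \<subseteq> A \<longleftrightarrow> B \<subseteq> h ` A" "A \<subseteq> inv_into X h ` B \<longleftrightarrow> h ` A \<subseteq> B"
    by (metis * image_mono)+
qed

text \<open>A competitor on \<open>Y\<close> is pulled back to \<open>X\<close> along the inverse
  isomorphism, compared with \<open>\<X>\<close> there, and the inclusions of parts are pushed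
  forward again. The functions then agree by \<open>coarser_if_parts_subset\<close>.\<close>

lemma coarsest_plonka_partition_transport:
  assumes M: "right_plonka_magma X m" and h: "magma_isomorphism h X m Y n"
    and c: "coarsest_plonka_partition X m \<X>"
  shows "coarsest_plonka_partition Y n (transport h X \<X>)"
  unfolding coarsest_plonka_partition_def
proof (intro conjI allI impI)
  have p: "plonka_partition X m \<X>" using c unfolding coarsest_plonka_partition_def by blast
  show t: "plonka_partition Y n (transport h X \<X>)" by (rule plonka_partition_transport[OF h p])
  have bij: "bij_betw h X Y" using h unfolding magma_isomorphism_def by blast
  have h': "magma_isomorphism (inv_into X h) Y n X m"
    using magma_isomorphism_inv_into[OF h] M unfolding right_plonka_magma_def by blast
  fix \<Y> :: "('b set, 'b) part_system"
  assume q: "plonka_partition Y n \<Y>"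
  \<comment> \<open>The pulled-back competitor is still indexed by sets of elements of
    \<open>Y\<close>, so the comparison has to come from \<open>coarsest_coarser\<close>, which
    allows any index type.\<close>
  have "coarser \<X> (transport (inv_into X h) Y \<Y>)"
    by (rule coarsest_coarser[OF c plonka_partition_transport[OF h' q]])
  then show "coarser (transport h X \<X>) \<Y>"
    using subset_transport_inv_into(1)[OF bij plonka_partition_part_subset[OF p]
        plonka_partition_part_subset[OF q]]
    by (intro coarser_if_parts_subset[OF t q]) (simp add: coarser_def)
qed

text \<open>The same pullback, with the inclusions of parts in the opposite direction.\<close>

lemma finest_plonka_partition_transport:
  assumes M: "right_plonka_magma X m" and h: "magma_isomorphism h X m Y n"
    and f: "finest_plonka_partition X m \<X>"
  shows "finest_plonka_partition Y n (transport h X \<X>)"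
  unfolding finest_plonka_partition_def
proof (intro conjI allI impI)
  have p: "plonka_partition X m \<X>" using f unfolding finest_plonka_partition_def by blast
  show t: "plonka_partition Y n (transport h X \<X>)" by (rule plonka_partition_transport[OF h p])
  have bij: "bij_betw h X Y" using h unfolding magma_isomorphism_def by blast
  have h': "magma_isomorphism (inv_into X h) Y n X m"
    using magma_isomorphism_inv_into[OF h] M unfolding right_plonka_magma_def by blast
  fix \<Y> :: "('b set, 'b) part_system"
  assume q: "plonka_partition Y n \<Y>"
  have "coarser (transport (inv_into X h) Y \<Y>) \<X>"
    by (rule finest_finer[OF f plonka_partition_transport[OF h' q]])
  then show "coarser \<Y> (transport h X \<X>)"
    using subset_transport_inv_into(2)[OF bij plonka_partition_part_subset[OF p]
        plonka_partition_part_subset[OF q]]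
    by (intro coarser_if_parts_subset[OF q t]) (simp add: coarser_def)
qed

section \<open>Uniqueness of the extreme partitions up to indexing\<close>

lemma coarsest_plonka_partition_unique:
  assumes "coarsest_plonka_partition X m \<X>" "coarsest_plonka_partition X m \<Y>"
  shows "part \<X> ` index \<X> = part \<Y> ` index \<Y>"
proof -
  have "plonka_partition X m \<X>" "plonka_partition X m \<Y>"
    using assms unfolding coarsest_plonka_partition_def by blast+
  then show ?thesis using coarser_antisym_parts assms[THEN coarsest_coarser] by blast
qed

lemma finest_plonka_partition_unique:
  assumes "finest_plonka_partition X m \<X>" "finest_plonka_partition X m \<Y>"
  shows "part \<X> ` index \<X> = part \<Y> ` index \<Y>"
proof -
  have "plonka_partition X m \<X>" "plonka_partition X m \<Y>"
    using assms unfolding finest_plonka_partition_def by blast+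
  then show ?thesis using coarser_antisym_parts assms[THEN finest_finer] by blast
qed

section \<open>Isomorphisms of magmas versus isomorphisms of partitions\<close>

lemma part_systems_isomorphic_if_parts_eq:
  assumes h: "magma_isomorphism h X m Y n"
    and p: "plonka_partition X m \<X>" and q: "plonka_partition Y n \<Y>"
    and parts: "part (transport h X \<X>) ` index \<X> = part \<Y> ` index \<Y>"
  shows "part_systems_isomorphic \<X> \<Y>"
proof -
  \<comment> \<open>An index \<open>i\<close> goes to the index of the part of \<open>\<Y>\<close>
    that equals the image of \<open>part \<X> i\<close> under \<open>h\<close>. Both factors are
    bijective because distinct indices have distinct parts.\<close>
  define \<theta> where "\<theta> = inv_into (index \<Y>) (part \<Y>) \<circ> part (transport h X \<X>)"
  have "inj_on (part (transport h X \<X>)) (index \<X>)"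
    using plonka_partition_inj_on_part[OF plonka_partition_transport[OF h p]] by simp
  then have "bij_betw (part (transport h X \<X>)) (index \<X>) (part \<Y> ` index \<Y>)"
    unfolding bij_betw_def using parts by blast
  moreover have "bij_betw (inv_into (index \<Y>) (part \<Y>)) (part \<Y> ` index \<Y>) (index \<Y>)"
    using plonka_partition_inj_on_part[OF q] by (intro bij_betw_inv_into inj_on_imp_bij_betw)
  ultimately have \<theta>: "bij_betw \<theta> (index \<X>) (index \<Y>)"
    unfolding \<theta>_def by (rule bij_betw_trans)
  have \<theta>_in: "\<theta> i \<in> index \<Y>" if "i \<in> index \<X>" for i
    using \<theta> that by (rule bij_betw_apply)
  have part_\<theta>: "part \<Y> (\<theta> i) = h ` part \<X> i" if "i \<in> index \<X>" for i
  proof -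
    have "part (transport h X \<X>) i \<in> part \<Y> ` index \<Y>" using parts that by blast
    then show ?thesis unfolding \<theta>_def o_apply by (subst f_inv_into_f) simp_all
  qed
  have bij: "bij_betw h X Y" and hom: "\<And>x y. x \<in> X \<Longrightarrow> y \<in> X \<Longrightarrow> h (m x y) = n (h x) (h y)"
    using h unfolding magma_isomorphism_def by auto
  note sub = plonka_partition_part_subset[OF p]
  have "family_isomorphic (index \<X>) (part \<X> i) (func \<X> i)
      (part \<Y> (\<theta> i)) (\<lambda>j. func \<Y> (\<theta> i) (\<theta> j))" if i: "i \<in> index \<X>" for i
    unfolding family_isomorphic_def
  \<comment> \<open>The single map \<open>h\<close>, restricted to each part, serves as every
    \<sigma>_i.\<close>
  proof (intro exI[of _ h] conjI ballI)
    show "bij_betw h (part \<X> i) (part \<Y> (\<theta> i))"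
      using bij_betw_subset[OF bij sub[OF i]] part_\<theta>[OF i] by simp
    fix j x assume j: "j \<in> index \<X>" and x: "x \<in> part \<X> i"
    \<comment> \<open>A point of the \<open>j\<close>-th part turns both functions into products, on
      which \<open>h\<close> is multiplicative.\<close>
    obtain y where y: "y \<in> part \<X> j" using plonka_partition_part_nonempty[OF p j] by blast
    have "h (func \<X> i j x) = n (h x) (h y)"
      using hom sub i j x y plonka_partition_func[OF p i j x y] by (metis subsetD)
    also have "\<dots> = func \<Y> (\<theta> i) (\<theta> j) (h x)"
      using plonka_partition_func[OF q \<theta>_in[OF i] \<theta>_in[OF j], of "h x" "h y"] part_\<theta> i j x y by simp
    finally show "h (func \<X> i j x) = func \<Y> (\<theta> i) (\<theta> j) (h x)" .
  qed
  then show ?thesis unfolding part_systems_isomorphic_def using \<theta> by blast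
qed

text \<open>The maps \<sigma>_i glue to a bijection because their domains partition \<open>X\<close>
  and, \<theta> being bijective, their images partition \<open>Y\<close>. The result is stated for
  arbitrary partitions so that it covers the coarsest and the finest ones alike.\<close>

lemma magma_isomorphic_if_part_systems_isomorphic:
  assumes p: "plonka_partition X m \<X>" and q: "plonka_partition Y n \<Y>"
    and iso: "part_systems_isomorphic \<X> \<Y>"
  shows "magma_isomorphic X m Y n"
proof -
  obtain \<theta> where \<theta>: "bij_betw \<theta> (index \<X>) (index \<Y>)"
    and fam: "\<forall>i\<in>index \<X>. \<exists>\<sigma>. bij_betw \<sigma> (part \<X> i) (part \<Y> (\<theta> i)) \<and>
      (\<forall>j\<in>index \<X>. \<forall>x\<in>part \<X> i. \<sigma> (func \<X> i j x) = func \<Y> (\<theta> i) (\<theta> j) (\<sigma> x))"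
    using iso unfolding part_systems_isomorphic_def family_isomorphic_def by blast
  obtain \<sigma> where \<sigma>: "\<And>i. i \<in> index \<X> \<Longrightarrow> bij_betw (\<sigma> i) (part \<X> i) (part \<Y> (\<theta> i))"
    and \<sigma>_func: "\<And>i j x. i \<in> index \<X> \<Longrightarrow> j \<in> index \<X> \<Longrightarrow> x \<in> part \<X> i \<Longrightarrow>
      \<sigma> i (func \<X> i j x) = func \<Y> (\<theta> i) (\<theta> j) (\<sigma> i x)"
    using bchoice[OF fam] by blast
  \<comment> \<open>On \<open>X\<close> the description picks the index of the only part containing
    \<open>x\<close>; elsewhere the value is irrelevant.\<close>
  define h where "h x = \<sigma> (THE i. i \<in> index \<X> \<and> x \<in> part \<X> i) x" for x
  have h: "h x = \<sigma> i x" if "i \<in> index \<X>" "x \<in> part \<X> i" for i x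
  proof -
    have "(THE i. i \<in> index \<X> \<and> x \<in> part \<X> i) = i"
      using that plonka_partition_index_unique[OF p] by blast
    then show ?thesis unfolding h_def by simp
  qed
  have X: "(\<Union>i\<in>index \<X>. part \<X> i) = X" and Y: "(\<Union>k\<in>index \<Y>. part \<Y> k) = Y"
    using p q unfolding plonka_partition_def by simp_all
  have \<theta>_in: "\<theta> i \<in> index \<Y>" if "i \<in> index \<X>" for i
    using \<theta> that by (rule bij_betw_apply)
  have h_in: "h x \<in> part \<Y> (\<theta> i)" if "i \<in> index \<X>" "x \<in> part \<X> i" for i x
    using h[OF that] bij_betw_apply[OF \<sigma>] that by simp
  have "bij_betw h X Y"
    unfolding bij_betw_def
  proof (intro conjI inj_onI)
    fix x y assume xy: "x \<in> X" "y \<in> X" "h x = h y"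
    obtain i j where ij: "i \<in> index \<X>" "x \<in> part \<X> i" "j \<in> index \<X>" "y \<in> part \<X> j"
      using X xy by blast
    \<comment> \<open>Equal images lie in a common part of \<open>\<Y>\<close>, which forces
      \<open>x\<close> and \<open>y\<close> into the same part, where \<sigma>_i is
      injective.\<close>
    have "\<theta> i = \<theta> j"
      using plonka_partition_index_unique[OF q \<theta>_in[OF ij(1)] \<theta>_in[OF ij(3)]]
        h_in[OF ij(1,2)] h_in[OF ij(3,4)] xy(3) by simp
    then have "i = j" using \<theta> ij unfolding bij_betw_def inj_on_def by blast
    then have "\<sigma> i x = \<sigma> i y" using h[OF ij(1,2)] h[OF ij(3,4)] xy(3) by simp
    then show "x = y"
      using inj_onD[OF bij_betw_imp_inj_on[OF \<sigma>[OF ij(1)]]] ij \<open>i = j\<close> by blast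
  next
    have "h ` X = (\<Union>i\<in>index \<X>. h ` part \<X> i)" using X by blast
    also have "\<dots> = (\<Union>i\<in>index \<X>. part \<Y> (\<theta> i))"
    proof (intro SUP_cong refl)
      fix i assume i: "i \<in> index \<X>"
      have "h ` part \<X> i = \<sigma> i ` part \<X> i" using h[OF i] by (rule image_cong[OF refl])
      then show "h ` part \<X> i = part \<Y> (\<theta> i)"
        using bij_betw_imp_surj_on[OF \<sigma>[OF i]] by simp
    qed
    also have "\<dots> = (\<Union>k\<in>\<theta> ` index \<X>. part \<Y> k)" by simp
    also have "\<dots> = Y" using Y bij_betw_imp_surj_on[OF \<theta>] by simp
    finally show "h ` X = Y" .
  qed
  moreover have "h (m x y) = n (h x) (h y)" if xy: "x \<in> X" "y \<in> X" for x y
  proof -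
    obtain i j where ij: "i \<in> index \<X>" "x \<in> part \<X> i" "j \<in> index \<X>" "y \<in> part \<X> j"
      using X xy by blast
    \<comment> \<open>The product stays in the part of its left factor, so \<open>h\<close> acts on
      it by the same \<sigma>_i as on \<open>x\<close>.\<close>
    have "func \<X> i j x \<in> part \<X> i" using p ij unfolding plonka_partition_def by blast
    then have "h (m x y) = \<sigma> i (func \<X> i j x)"
      using plonka_partition_func[OF p ij(1,3,2,4)] h[OF ij(1)] by simp
    also have "\<dots> = func \<Y> (\<theta> i) (\<theta> j) (h x)"
      using \<sigma>_func[OF ij(1,3,2)] h[OF ij(1,2)] by simp
    also have "\<dots> = n (h x) (h y)"
      by (rule plonka_partition_func[OF q]) (use \<theta>_in h_in ij in auto)
    finally show ?thesis .
  qed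
  ultimately show ?thesis unfolding magma_isomorphic_def by blast
qed

theorem theorem3p19:
  fixes X :: "'a set" and m :: "'a \<Rightarrow> 'a \<Rightarrow> 'a"
    and Y :: "'b set" and n :: "'b \<Rightarrow> 'b \<Rightarrow> 'b"
    and \<X>c :: "('i, 'a) part_system" and \<Y>c :: "('k, 'b) part_system"
    and \<X>f :: "('p, 'a) part_system" and \<Y>f :: "('q, 'b) part_system"
  assumes "right_plonka_magma X m" and "right_plonka_magma Y n"
    and "coarsest_plonka_partition X m \<X>c" and "coarsest_plonka_partition Y n \<Y>c"
    and "finest_plonka_partition X m \<X>f" and "finest_plonka_partition Y n \<Y>f"
  shows "(magma_isomorphic X m Y n \<longleftrightarrow> part_systems_isomorphic \<X>c \<Y>c) \<and>
         (magma_isomorphic X m Y n \<longleftrightarrow> part_systems_isomorphic \<X>f \<Y>f)"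
proof (intro conjI iffI)
  have parts: "plonka_partition X m \<X>c" "plonka_partition Y n \<Y>c"
    "plonka_partition X m \<X>f" "plonka_partition Y n \<Y>f"
    using assms unfolding coarsest_plonka_partition_def finest_plonka_partition_def by blast+
  show "magma_isomorphic X m Y n" if "part_systems_isomorphic \<X>c \<Y>c"
    by (rule magma_isomorphic_if_part_systems_isomorphic[OF parts(1,2) that])
  show "magma_isomorphic X m Y n" if "part_systems_isomorphic \<X>f \<Y>f"
    by (rule magma_isomorphic_if_part_systems_isomorphic[OF parts(3,4) that])
  assume "magma_isomorphic X m Y n"
  then obtain h where h: "magma_isomorphism h X m Y n" unfolding magma_isomorphic_iff by blast
  \<comment> \<open>The transport of \<open>\<X>c\<close> and \<open>\<Y>c\<close> itself are both
    coarsest for \<open>Y\<close>, so they have the same parts; the finest case is parallel.\<close>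
  show "part_systems_isomorphic \<X>c \<Y>c"
    using coarsest_plonka_partition_unique[OF
        coarsest_plonka_partition_transport[OF assms(1) h assms(3)] assms(4)]
    by (intro part_systems_isomorphic_if_parts_eq[OF h parts(1,2)]) simp
  show "part_systems_isomorphic \<X>f \<Y>f"
    using finest_plonka_partition_unique[OF
        finest_plonka_partition_transport[OF assms(1) h assms(5)] assms(6)]
    by (intro part_systems_isomorphic_if_parts_eq[OF h parts(3,4)]) simp
qed

end
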